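(* Let $d_1,\dots,d_k$ be positive integers, write $\mathbb{R}^{\mathbf d}=\mathbb{R}^{d_1}\times\dots\times\mathbb{R}^{d_k}$, and let $f_1,\dots,f_J\colon\mathbb{R}^{\mathbf d}\to\mathbb{R}$ be polynomials. Suppose $\mathcal{F}_i\subset\mathbb{R}^{d_i}$, $i=1,\dots,k$, are finite multisets of points. Then there are submultisets $\mathcal{F}_i'\subset\mathcal{F}_i$ such that (1) $|\mathcal{F}_i'|\geq\varepsilon|\mathcal{F}_i|$ for each $i$, where $\varepsilon=\prod_{j=1}^J 3^{-3^{t_2(f_j)+\dots+t_k(f_j)}}$; and (2) for each $j$, the sign of $f_j(p_1,\dots,p_k)$ is the same for all choices of $p_i\in\mathcal{F}_i'$, $i=1,\dots,k$.
   Context: For a polynomial $f$ on $\mathbb{R}^{\mathbf d}$, the number of terms of $f$ on the $i$-th component, $t_i(f)$, is the number of monomials of $f$ when $f$ is regarded as a polynomial in the coordinates of the $i$-th factor $\mathbb{R}^{d_i}$ (with the coordinates of the other factors treated as fixed coefficients). For example, if $\mathbf d=(1,1)$ and $f(x_1,x_2)=4+2x_1x_2+3x_1x_2^2+x_1x_2^3+7x_1^2x_2$, then $t_1(f)=3$ and $t_2(f)=4$. The sign of $x\in\mathbb{R}$ is $+1$, $-1$ or $0$ according as $x>0$, $x<0$ or $x=0$. Multisets are counted with multiplicity. *)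

theory Defs
  imports "HOL-Library.Poly_Mapping" "HOL-Library.Multiset" "Jordan_Normal_Form.Matrix"
begin

text \<open>
  The variable \<open>(i, l)\<close> stands for the coordinate \<open>l\<close> of a point of the \<open>i\<close>-th factor. Factors are
  numbered from 1, coordinates from 0 as for vectors.
\<close>

type_synonym monom = "(nat \<times> nat) \<Rightarrow>\<^sub>0 nat"
type_synonym rpoly = "monom \<Rightarrow>\<^sub>0 real"

definition polys_on :: "nat \<Rightarrow> (nat \<Rightarrow> nat) \<Rightarrow> rpoly set" where
  "polys_on k d = {f. \<forall>m\<in>Poly_Mapping.keys f. Poly_Mapping.keys m \<subseteq> (SIGMA i:{1..k}. {..<d i})}"

definition eval_monom :: "monom \<Rightarrow> (nat \<Rightarrow> real vec) \<Rightarrow> real" where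
  "eval_monom m p = (\<Prod>v\<in>Poly_Mapping.keys m. (p (fst v) $ snd v) ^ Poly_Mapping.lookup m v)"

definition eval_rpoly :: "rpoly \<Rightarrow> (nat \<Rightarrow> real vec) \<Rightarrow> real" where
  "eval_rpoly f p = (\<Sum>m\<in>Poly_Mapping.keys f. Poly_Mapping.lookup f m * eval_monom m p)"

lift_definition factor_part :: "nat \<Rightarrow> monom \<Rightarrow> monom" is
  "\<lambda>i m v. if fst v = i then m v else 0"
  by (rule finite_subset[rotated]) auto

text \<open>
  The polynomial \<open>f\<close> as a polynomial in the coordinates of the \<open>i\<close>-th factor whose coefficients are
  polynomials in the coordinates of the other factors.
\<close>

definition as_poly_in :: "nat \<Rightarrow> rpoly \<Rightarrow> (monom \<Rightarrow>\<^sub>0 rpoly)" where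
  "as_poly_in i f = (\<Sum>m\<in>Poly_Mapping.keys f.
     Poly_Mapping.single (factor_part i m)
       (Poly_Mapping.single (m - factor_part i m) (Poly_Mapping.lookup f m)))"

definition num_terms :: "nat \<Rightarrow> rpoly \<Rightarrow> nat" where
  "num_terms i f = card (Poly_Mapping.keys (as_poly_in i f))"

lemma factor_part_add_rest: "factor_part i m + (m - factor_part i m) = m"
  by (rule poly_mapping_eqI) (simp add: lookup_add lookup_minus factor_part.rep_eq)

lemma keys_as_poly_in: "Poly_Mapping.keys (as_poly_in i f) = factor_part i ` Poly_Mapping.keys f"
proof
  show "Poly_Mapping.keys (as_poly_in i f) \<subseteq> factor_part i ` Poly_Mapping.keys f"
  proof
    fix e assume e: "e \<in> Poly_Mapping.keys (as_poly_in i f)"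
    show "e \<in> factor_part i ` Poly_Mapping.keys f"
    proof (rule ccontr)
      assume "e \<notin> factor_part i ` Poly_Mapping.keys f"
      then have "Poly_Mapping.lookup (as_poly_in i f) e = 0"
        unfolding as_poly_in_def lookup_sum
        by (intro sum.neutral) (auto simp: lookup_single when_def)
      with e show False by (simp add: in_keys_iff)
    qed
  qed
next
  show "factor_part i ` Poly_Mapping.keys f \<subseteq> Poly_Mapping.keys (as_poly_in i f)"
  proof
    fix e assume "e \<in> factor_part i ` Poly_Mapping.keys f"
    then obtain m where m: "m \<in> Poly_Mapping.keys f" and e: "e = factor_part i m" by auto
    have "Poly_Mapping.lookup (Poly_Mapping.lookup (as_poly_in i f) e) (m - e)
      = (\<Sum>n\<in>Poly_Mapping.keys f. if n = m then Poly_Mapping.lookup f n else 0)"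
      unfolding as_poly_in_def lookup_sum e
      by (rule sum.cong[OF refl])
        (auto simp: lookup_single when_def, metis factor_part_add_rest)
    also have "\<dots> = Poly_Mapping.lookup f m" using m by simp
    also have "\<dots> \<noteq> 0" using m by (simp add: in_keys_iff)
    finally show "e \<in> Poly_Mapping.keys (as_poly_in i f)" by (auto simp: in_keys_iff)
  qed
qed

lemma num_terms_eq: "num_terms i f = card (factor_part i ` Poly_Mapping.keys f)"
  by (simp add: num_terms_def keys_as_poly_in)

end

theory Submission
  imports Defs
begin

text \<open>
  Regard \<open>f\<close> as a linear form in its \<open>t\<close> monomials in the last factor, with coefficients that are
  polynomials in the other factors. By induction on the number of factors, the other multisets can
  be refined so that any single linear combination of these coefficients has constant sign. Megiddo's
  multidimensional search then finds, with at most \<open>3 ^ t\<close> such refinements, a proportion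
  \<open>1 / 3 ^ 3 ^ t\<close> of the points of the last factor on which \<open>f\<close> has constant sign: normalise the
  last coefficient to 1, split the forms at the median of their second to last coefficient, and for
  all pairs of a form below and a form above the median eliminate either of the two coefficients.
  The signs of the two resulting forms, known for many pairs by induction on \<open>t\<close>, determine the sign
  of one member of each pair.
\<close>

section \<open>Counting\<close>

lemma sgn_real_cases: "sgn (x::real) = 1 \<or> sgn x = 0 \<or> sgn x = -1"
  by (simp add: sgn_if)

text \<open>Pigeonhole over the three possible signs. This is the source of the base 3 in the
  bound.\<close>

lemma large_sign_class:
  fixes \<alpha> :: "'i \<Rightarrow> real"
  assumes "finite I"
  shows "\<exists>s. card I \<le> 3 * card {i\<in>I. sgn (\<alpha> i) = s}"
proof (rule ccontr)
  assume "\<not> ?thesis"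
  then have small: "3 * card {i\<in>I. sgn (\<alpha> i) = s} < card I" for s
    by (simp add: not_le)
  have "I \<subseteq> {i\<in>I. sgn (\<alpha> i) = 1} \<union> {i\<in>I. sgn (\<alpha> i) = 0} \<union> {i\<in>I. sgn (\<alpha> i) = -1}"
    using sgn_real_cases by blast
  with assms have "card I \<le> card ({i\<in>I. sgn (\<alpha> i) = 1} \<union> {i\<in>I. sgn (\<alpha> i) = 0} \<union> {i\<in>I. sgn (\<alpha> i) = -1})"
    by (intro card_mono) auto
  also have "\<dots> \<le> card {i\<in>I. sgn (\<alpha> i) = 1} + card {i\<in>I. sgn (\<alpha> i) = 0} + card {i\<in>I. sgn (\<alpha> i) = -1}"
    by (meson add_le_mono card_Un_le le_refl le_trans)
  finally show False
    using small[of 1] small[of 0] small[of "-1"] by linarith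
qed

text \<open>The median is the least value \<open>\<sigma>\<close> of \<open>s\<close> with at least
  half of \<open>I\<close> at or below it; at most half then lies strictly below. Ties at
  \<open>\<sigma>\<close> count on both sides.\<close>

lemma median_exists:
  fixes s :: "'i \<Rightarrow> real"
  assumes "finite I" "I \<noteq> {}"
  obtains \<sigma> where "card I \<le> 2 * card {i\<in>I. s i \<le> \<sigma>}" "card I \<le> 2 * card {i\<in>I. s i \<ge> \<sigma>}"
proof -
  define L where "L = {\<tau>\<in>s ` I. card I \<le> 2 * card {i\<in>I. s i \<le> \<tau>}}"
  have "{i\<in>I. s i \<le> Max (s ` I)} = I"
    using assms by auto
  then have "Max (s ` I) \<in> L"
    using assms by (simp add: L_def)
  moreover have finL: "finite L"
    using assms by (simp add: L_def)
  ultimately have \<sigma>: "Min L \<in> L" by (metis Min_in empty_iff)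
  define D where "D = {i\<in>I. s i < Min L}"
  have D: "2 * card D \<le> card I"
  proof (cases "D = {}")
    case False
    \<comment> \<open>All of \<open>D\<close> lies at or below its largest value, which is smaller
      than \<open>Min L\<close> and hence outside \<open>L\<close>.\<close>
    define \<tau> where "\<tau> = Max (s ` D)"
    have finD: "finite D" using assms by (simp add: D_def)
    have \<tau>: "\<tau> \<in> s ` D" using False finD by (simp add: \<tau>_def)
    then have "\<tau> < Min L" "\<tau> \<in> s ` I" by (auto simp: D_def)
    then have "\<tau> \<notin> L" using finL by (metis Min_le not_le)
    moreover have "D \<subseteq> {i\<in>I. s i \<le> \<tau>}"
      using finD by (auto simp: D_def \<tau>_def)
    then have "card D \<le> card {i\<in>I. s i \<le> \<tau>}"
      using assms by (intro card_mono) auto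
    ultimately show ?thesis using \<open>\<tau> \<in> s ` I\<close> by (simp add: L_def)
  qed simp
  have "I = D \<union> {i\<in>I. s i \<ge> Min L}" by (auto simp: D_def)
  then have "card I = card (D \<union> {i\<in>I. s i \<ge> Min L})" by simp
  moreover have "card (D \<union> {i\<in>I. s i \<ge> Min L}) \<le> card D + card {i\<in>I. s i \<ge> Min L}"
    by (rule card_Un_le)
  ultimately have "card I \<le> 2 * card {i\<in>I. s i \<ge> Min L}"
    using D by linarith
  then show thesis using that[of "Min L"] \<sigma> by (simp add: L_def)
qed

text \<open>An element of \<open>A\<close> is the first coordinate of at most \<open>card B\<close>
  pairs, so a dense set of pairs has an equally dense projection. This turns knowledge about pairs
  of forms back into knowledge about single forms.\<close>

lemma card_times_le_imp_card_fst_le: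
  assumes "finite A" "finite B" "B \<noteq> {}" "E \<subseteq> A \<times> B" "card (A \<times> B) \<le> N * card E"
  shows "card A \<le> N * card (fst ` E)"
proof -
  have "finite E" using assms finite_subset by blast
  moreover have "E \<subseteq> fst ` E \<times> B" using assms(4) by force
  ultimately have *: "card E \<le> card (fst ` E) * card B"
    using card_mono[of "fst ` E \<times> B" E] assms(2) by (simp add: card_cartesian_product)
  have "card A * card B \<le> N * card E"
    using assms(5) by (simp add: card_cartesian_product)
  also have "\<dots> \<le> N * (card (fst ` E) * card B)"
    using * by (rule mult_le_mono2)
  also have "\<dots> = N * card (fst ` E) * card B"
    by (simp only: mult.assoc)
  finally show ?thesis
    using assms(2,3) by (simp only: mult_le_cancel2) (simp add: card_gt_0_iff)
qed

lemma card_times_le_imp_card_snd_le: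
  assumes "finite A" "finite B" "A \<noteq> {}" "E \<subseteq> A \<times> B" "card (A \<times> B) \<le> N * card E"
  shows "card B \<le> N * card (snd ` E)"
proof -
  have "card (B \<times> A) \<le> N * card (prod.swap ` E)"
    using assms(5) by (simp add: card_cartesian_product mult.commute card_image)
  moreover have "prod.swap ` E \<subseteq> B \<times> A" using assms(4) by auto
  ultimately have "card B \<le> N * card (fst ` prod.swap ` E)"
    using assms by (intro card_times_le_imp_card_fst_le) auto
  then show ?thesis by (simp add: image_image)
qed

section \<open>Multidimensional search\<close>

definition constant_sign_on :: "('a \<Rightarrow> real) \<Rightarrow> 'a set \<Rightarrow> bool" where
  "constant_sign_on g Z \<longleftrightarrow> (\<exists>s. \<forall>z\<in>Z. sgn (g z) = s)"

text \<open>
  \<open>refines m R R'\<close> says that \<open>R'\<close> is a refinement of \<open>R\<close> of cost at most \<open>m\<close>.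
\<close>

locale sign_refinement =
  fixes pts :: "'r \<Rightarrow> 'x set"
    and refines :: "nat \<Rightarrow> 'r \<Rightarrow> 'r \<Rightarrow> bool"
    and W :: "('x \<Rightarrow> real) set"
  assumes refines_refl: "refines 0 R R"
    and refines_trans: "refines m R R' \<Longrightarrow> refines n R' R'' \<Longrightarrow> refines (m + n) R R''"
    and refines_mono: "refines m R R' \<Longrightarrow> m \<le> n \<Longrightarrow> refines n R R'"
    and refines_pts: "refines m R R' \<Longrightarrow> pts R' \<subseteq> pts R"
    and W_add_scaled: "g \<in> W \<Longrightarrow> h \<in> W \<Longrightarrow> (\<lambda>x. r * g x + h x) \<in> W"
    and W_refines: "h \<in> W \<Longrightarrow> \<exists>R'. refines 1 R R' \<and> constant_sign_on h (pts R')"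
begin

text \<open>Form \<open>i\<close> is the combination of the functions \<open>c e\<close> with
  coefficients \<open>a i e\<close>. Two costs are tracked: \<open>m\<close> for the refinements
  spent on the domain, and \<open>N\<close> for the factor lost in the number of forms.\<close>

definition searchable :: "nat \<Rightarrow> (nat \<Rightarrow> 'x \<Rightarrow> real) \<Rightarrow> 'i set \<Rightarrow> ('i \<Rightarrow> nat \<Rightarrow> real) \<Rightarrow> 'r \<Rightarrow> nat \<Rightarrow> nat \<Rightarrow> bool" where
  "searchable t c I a R m N \<longleftrightarrow> (\<exists>R' I'. refines m R R' \<and> I' \<subseteq> I \<and> card I \<le> N * card I' \<and>
     constant_sign_on (\<lambda>(x, i). \<Sum>e<t. a i e * c e x) (pts R' \<times> I'))"

lemma searchableE:
  assumes "searchable t c I a R m N"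
  obtains R' I' s where "refines m R R'" "I' \<subseteq> I" "card I \<le> N * card I'"
    "\<And>x i. x \<in> pts R' \<Longrightarrow> i \<in> I' \<Longrightarrow> sgn (\<Sum>e<t. a i e * c e x) = s"
proof -
  obtain R' I' s where *: "refines m R R'" "I' \<subseteq> I" "card I \<le> N * card I'"
    and s: "\<forall>z\<in>pts R' \<times> I'. sgn ((\<lambda>(x, i). \<Sum>e<t. a i e * c e x) z) = s"
    using assms unfolding searchable_def constant_sign_on_def by blast
  show thesis
  proof (rule that[OF *])
    show "sgn (\<Sum>e<t. a i e * c e x) = s" if "x \<in> pts R'" "i \<in> I'" for x i
      using bspec[OF s, of "(x, i)"] that by simp
  qed
qed

lemma searchable_mono:
  assumes "searchable t c I a R m N" "m \<le> m'" "N \<le> N'"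
  shows "searchable t c I a R m' N'"
proof -
  obtain R' I' where *: "refines m R R'" "I' \<subseteq> I" "card I \<le> N * card I'"
    "constant_sign_on (\<lambda>(x, i). \<Sum>e<t. a i e * c e x) (pts R' \<times> I')"
    using assms(1) unfolding searchable_def by blast
  have "card I \<le> N' * card I'"
    using *(3) assms(3) by (meson mult_le_mono1 order_trans)
  with * refines_mono[OF *(1) assms(2)] show ?thesis
    unfolding searchable_def by (intro exI[of _ R'] exI[of _ I'] conjI)
qed

lemma searchable_subset:
  assumes "searchable t c J a R m N" "J \<subseteq> I" "card I \<le> r * card J"
  shows "searchable t c I a R m (r * N)"
proof -
  obtain R' I' where *: "refines m R R'" "I' \<subseteq> J" "card J \<le> N * card I'"
    "constant_sign_on (\<lambda>(x, i). \<Sum>e<t. a i e * c e x) (pts R' \<times> I')"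
    using assms(1) unfolding searchable_def by blast
  have "card I \<le> r * (N * card I')"
    using assms(3) *(3) by (meson mult_le_mono2 order_trans)
  with * assms(2) show ?thesis
    unfolding searchable_def
    by (intro exI[of _ R'] exI[of _ I'] conjI) (auto simp: mult.assoc)
qed

text \<open>A common sign of the factors \<open>r i\<close> multiplies the constant sign. With
  \<open>r i = 1\<close> this covers dropping or merging terms; with the last coefficient as factor
  it undoes normalisation.\<close>

lemma searchable_cong:
  assumes "searchable t c I a R m N"
    and "\<And>x i. i \<in> I \<Longrightarrow> (\<Sum>e<t'. a' i e * c' e x) = r i * (\<Sum>e<t. a i e * c e x)"
    and "\<And>i. i \<in> I \<Longrightarrow> sgn (r i) = s"
  shows "searchable t' c' I a' R m N"
proof -
  obtain R' I' s' where *: "refines m R R'" "I' \<subseteq> I" "card I \<le> N * card I'"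
    and s': "\<And>x i. x \<in> pts R' \<Longrightarrow> i \<in> I' \<Longrightarrow> sgn (\<Sum>e<t. a i e * c e x) = s'"
    using searchableE[OF assms(1)] by blast
  have "sgn (\<Sum>e<t'. a' i e * c' e x) = s * s'" if "x \<in> pts R'" "i \<in> I'" for x i
    using that *(2) s'[OF that] assms(2)[of i x] assms(3)[of i]
    by (auto simp: sgn_mult)
  then have "constant_sign_on (\<lambda>(x, i). \<Sum>e<t'. a' i e * c' e x) (pts R' \<times> I')"
    unfolding constant_sign_on_def by auto
  with * show ?thesis unfolding searchable_def by blast
qed

text \<open>An induction hypothesis fixes the type of the indices, but the recursion passes from
  forms to pairs of forms. Indexing by \<open>nat\<close> and transporting along an injection gets
  around this.\<close>

lemma searchable_reindex:
  fixes I :: "'i set" and a :: "'i \<Rightarrow> nat \<Rightarrow> real"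
  assumes nat: "\<And>(J::nat set) a. finite J \<Longrightarrow> searchable t c J a R m N"
    and "finite I"
  shows "searchable t c I a R m N"
proof -
  obtain h :: "'i \<Rightarrow> nat" where h: "inj_on h I"
    using finite_imp_inj_to_nat_seg[OF \<open>finite I\<close>] by blast
  have "searchable t c (h ` I) (\<lambda>j. a (the_inv_into I h j)) R m N"
    using nat \<open>finite I\<close> by simp
  then obtain R' J' s where *: "refines m R R'" "J' \<subseteq> h ` I" "card (h ` I) \<le> N * card J'"
    and s: "\<And>x j. x \<in> pts R' \<Longrightarrow> j \<in> J' \<Longrightarrow> sgn (\<Sum>e<t. a (the_inv_into I h j) e * c e x) = s"
    using searchableE by blast
  define I' where "I' = {i\<in>I. h i \<in> J'}"
  have "h ` I' = J'" using *(2) by (auto simp: I'_def)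
  moreover have "inj_on h I'" using h by (auto simp: I'_def inj_on_def)
  ultimately have "card J' = card I'" by (metis card_image)
  moreover have "constant_sign_on (\<lambda>(x, i). \<Sum>e<t. a i e * c e x) (pts R' \<times> I')"
    unfolding constant_sign_on_def
  proof (intro exI[of _ s] ballI, clarify)
    fix x i assume "x \<in> pts R'" "i \<in> I'"
    then show "sgn (\<Sum>e<t. a i e * c e x) = s"
      using s[of x "h i"] h by (auto simp: I'_def the_inv_into_f_f)
  qed
  ultimately show ?thesis
    unfolding searchable_def using *(1,3) h
    by (intro exI[of _ R'] exI[of _ I']) (auto simp: I'_def card_image)
qed

section \<open>Megiddo's recursion on the number of terms\<close>

text \<open>Two searches with one term fewer, one for each eliminated coefficient, cost
  \<open>2 * m\<close> and a factor \<open>N * N\<close>; the factor 4 comes from the split at the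
  median.\<close>

lemma searchable_normalised:
  fixes I :: "nat set" and c :: "nat \<Rightarrow> 'x \<Rightarrow> real"
  assumes IH: "\<And>(J::nat set) a c R. finite J \<Longrightarrow> \<forall>e<Suc n. c e \<in> W \<Longrightarrow> searchable (Suc n) c J a R m N"
    and "N > 0" and "finite I" and cW: "\<forall>e<Suc (Suc n). c e \<in> W"
    and one: "\<And>i. i \<in> I \<Longrightarrow> a i (Suc n) = 1"
  shows "searchable (Suc (Suc n)) c I a R (2 * m) (4 * (N * N))"
proof (cases "I = {}")
  case True
  have "refines (2 * m) R R" using refines_mono[OF refines_refl] by simp
  with True show ?thesis
    unfolding searchable_def constant_sign_on_def by auto
next
  case False
  have IH': "searchable (Suc n) c' E b R m N"
    if "finite E" "\<forall>e<Suc n. c' e \<in> W" for c' R and E :: "(nat \<times> nat) set" and b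
    by (rule searchable_reindex) (use IH that in auto)
  obtain \<sigma> where A: "card I \<le> 2 * card {i\<in>I. a i n \<le> \<sigma>}"
    and B: "card I \<le> 2 * card {i\<in>I. a i n \<ge> \<sigma>}"
    using median_exists[OF \<open>finite I\<close> False, of "\<lambda>i. a i n"] by blast
  \<comment> \<open>The lower half is split into ties and forms strictly below, one of which holds a
    quarter of \<open>I\<close>. Strictness of \<open>A1\<close> keeps the denominator of
    \<open>\<mu>\<close> below positive.\<close>
  define A0 where "A0 = {i\<in>I. a i n = \<sigma>}"
  define A1 where "A1 = {i\<in>I. a i n < \<sigma>}"
  define B0 where "B0 = {i\<in>I. a i n \<ge> \<sigma>}"
  have fin: "finite A0" "finite A1" "finite B0"
    using \<open>finite I\<close> by (auto simp: A0_def A1_def B0_def)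
  have "{i\<in>I. a i n \<le> \<sigma>} = A0 \<union> A1" by (auto simp: A0_def A1_def)
  then have "card I \<le> 2 * (card A0 + card A1)"
    using A card_Un_le[of A0 A1] by simp
  then have "card I \<le> 4 * card A0 \<or> card I \<le> 4 * card A1" by arith
  then consider "card I \<le> 4 * card A0" | "card I \<le> 4 * card A1" by blast
  then show ?thesis
  proof cases
    case 1
    \<comment> \<open>On \<open>A0\<close> the last two coefficients are \<open>\<sigma>\<close> and
      1 throughout, so the last two terms merge into one with coefficient 1.\<close>
    define c' where "c' = c(n := \<lambda>x. \<sigma> * c n x + c (Suc n) x)"
    have c': "\<forall>e<Suc n. c' e \<in> W"
      using cW W_add_scaled by (auto simp: c'_def less_Suc_eq)
    have "searchable (Suc n) c' A0 (\<lambda>i. (a i)(n := 1)) R m N"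
      using IH fin c' by blast
    then have "searchable (Suc (Suc n)) c A0 a R m N"
      by (rule searchable_cong[where r = "\<lambda>_. 1" and s = 1])
        (auto simp: A0_def one c'_def algebra_simps)
    then have "searchable (Suc (Suc n)) c I a R m (4 * N)"
      using 1 by (rule_tac searchable_subset[where J = A0]) (auto simp: A0_def)
    then show ?thesis
      by (rule searchable_mono) (use \<open>N > 0\<close> in auto)
  next
    case 2
    have ne: "A1 \<noteq> {}" "B0 \<noteq> {}"
      using 2 B False \<open>finite I\<close> by (auto simp: B0_def[symmetric])
    define g where "g = (\<lambda>i x. \<Sum>e<Suc (Suc n). a i e * c e x)"
    \<comment> \<open>The weight for which the convex combination of \<open>g i\<close> and
      \<open>g j\<close> has coefficient \<open>\<sigma>\<close> at \<open>c n\<close>.\<close>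
    define \<mu> where "\<mu> = (\<lambda>(i, j). (\<sigma> - a i n) / (a j n - a i n))"
    define c' where "c' = c(n := \<lambda>x. \<sigma> * c n x + c (Suc n) x)"
    have c': "\<forall>e<Suc n. c' e \<in> W"
      using cW W_add_scaled by (auto simp: c'_def less_Suc_eq)
    \<comment> \<open>First elimination: both last coefficients are 1, so they cancel in the
      difference of the two forms.\<close>
    have "searchable (Suc n) c (A1 \<times> B0) (\<lambda>p e. a (fst p) e - a (snd p) e) R m N"
      using IH' fin cW by simp
    then obtain R1 E1 s1 where R1: "refines m R R1" and E1: "E1 \<subseteq> A1 \<times> B0"
      and cardE1: "card (A1 \<times> B0) \<le> N * card E1"
      and s1: "\<And>x p. x \<in> pts R1 \<Longrightarrow> p \<in> E1 \<Longrightarrow> sgn (\<Sum>e<Suc n. (a (fst p) e - a (snd p) e) * c e x) = s1"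
      using searchableE by blast
    \<comment> \<open>Second elimination: the combination ends in
      \<open>\<sigma> * c n x + c (Suc n) x\<close>, which is \<open>c' n x\<close> with coefficient
      1.\<close>
    define b where "b = (\<lambda>(i, j) e. if e = n then 1 else (1 - \<mu> (i, j)) * a i e + \<mu> (i, j) * a j e)"
    have "finite E1" using E1 fin finite_subset by blast
    \<comment> \<open>The second search starts from the outcome of the first, so on
      \<open>R2\<close> and \<open>E2\<close> both signs are known.\<close>
    then have "searchable (Suc n) c' E1 b R1 m N"
      using IH' c' by simp
    then obtain R2 E2 s2 where R2: "refines m R1 R2" and E2: "E2 \<subseteq> E1"
      and cardE2: "card E1 \<le> N * card E2"
      and s2: "\<And>x p. x \<in> pts R2 \<Longrightarrow> p \<in> E2 \<Longrightarrow> sgn (\<Sum>e<Suc n. b p e * c' e x) = s2"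
      using searchableE by blast
    have cardE: "card (A1 \<times> B0) \<le> N * N * card E2"
      using cardE1 cardE2 by (metis mult.assoc mult_le_mono2 order_trans)
    have EAB: "E2 \<subseteq> A1 \<times> B0" using E1 E2 by blast
    have y: "sgn (g i x - g j x) = s1" if "x \<in> pts R2" "(i, j) \<in> E2" for x i j
    proof -
      have "i \<in> I" "j \<in> I" using that EAB by (auto simp: A1_def B0_def)
      then have "g i x - g j x = (\<Sum>e<Suc n. (a i e - a j e) * c e x)"
        by (simp add: g_def one algebra_simps sum_subtractf)
      then show ?thesis using s1[of x "(i, j)"] that E2 refines_pts[OF R2] by auto
    qed
    have \<mu>: "0 < \<mu> (i, j)" "\<mu> (i, j) \<le> 1" if "(i, j) \<in> E2" for i j
      using that EAB by (auto simp: \<mu>_def A1_def B0_def divide_simps)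
    have z: "sgn ((1 - \<mu> (i, j)) * g i x + \<mu> (i, j) * g j x) = s2" if "x \<in> pts R2" "(i, j) \<in> E2" for x i j
    proof -
      have I: "i \<in> I" "j \<in> I" and lt: "a i n < a j n" using that EAB by (auto simp: A1_def B0_def)
      have slope: "(1 - \<mu> (i, j)) * a i n + \<mu> (i, j) * a j n = \<sigma>"
      proof -
        have "\<mu> (i, j) * (a j n - a i n) = \<sigma> - a i n" using lt by (simp add: \<mu>_def)
        then show ?thesis by (simp add: algebra_simps)
      qed
      have "(1 - \<mu> (i, j)) * g i x + \<mu> (i, j) * g j x
        = (\<Sum>e<Suc (Suc n). ((1 - \<mu> (i, j)) * a i e + \<mu> (i, j) * a j e) * c e x)"
        unfolding g_def sum_distrib_left sum.distrib[symmetric]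
        by (intro sum.cong) (simp_all add: algebra_simps)
      also have "\<dots> = (\<Sum>e<n. b (i, j) e * c' e x) + \<sigma> * c n x + c (Suc n) x"
        using I by (simp add: slope b_def c'_def one)
      also have "\<dots> = (\<Sum>e<Suc n. b (i, j) e * c' e x)"
        by (simp add: b_def c'_def)
      finally show ?thesis using s2[OF that] by simp
    qed
    have large: "card I \<le> 4 * (N * N) * card (fst ` E2)" "card I \<le> 4 * (N * N) * card (snd ` E2)"
      using card_times_le_imp_card_fst_le[OF fin(2,3) ne(2) EAB cardE]
        card_times_le_imp_card_snd_le[OF fin(2,3) ne(1) EAB cardE] 2 B
      by (auto simp: B0_def[symmetric])
    have ref: "refines (2 * m) R R2"
      using refines_trans[OF R1 R2] by (simp add: mult_2)
    have sub: "fst ` E2 \<subseteq> I" "snd ` E2 \<subseteq> I"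
      using EAB by (auto simp: A1_def B0_def)
    \<comment> \<open>With \<open>Y\<close> the difference and \<open>Z\<close> the combination,
      \<open>g i = Z + \<mu> Y\<close> and \<open>g j = Z - (1 - \<mu>) Y\<close>. If
      \<open>Y\<close> is zero or agrees in sign with \<open>Z \<noteq> 0\<close>, then
      \<open>g i\<close> has the sign of \<open>Z\<close>; if it is opposite, \<open>g j\<close> has
      it. If \<open>Z = 0\<close>, then \<open>g i\<close> has the sign of \<open>Y\<close> because
      \<open>\<mu> > 0\<close>. The choice between \<open>i\<close> and \<open>j\<close> depends
      only on \<open>s1\<close> and \<open>s2\<close>, hence is the same for all pairs.\<close>
    have "(\<exists>s. \<forall>x\<in>pts R2. \<forall>(i, j)\<in>E2. sgn (g i x) = s) \<or> (\<exists>s. \<forall>x\<in>pts R2. \<forall>(i, j)\<in>E2. sgn (g j x) = s)"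
    proof -
      define Y where "Y = (\<lambda>i j x. g i x - g j x)"
      define Z where "Z = (\<lambda>i j x. (1 - \<mu> (i, j)) * g i x + \<mu> (i, j) * g j x)"
      have gi: "g i x = Z i j x + \<mu> (i, j) * Y i j x"
        and gj: "g j x = Z i j x - (1 - \<mu> (i, j)) * Y i j x" for i j x
        by (simp_all add: Y_def Z_def algebra_simps)
      have sgnY: "sgn (Y i j x) = s1" and sgnZ: "sgn (Z i j x) = s2"
        if "x \<in> pts R2" "(i, j) \<in> E2" for i j x
        using y z that by (simp_all add: Y_def Z_def)
      consider "s2 > 0" "s1 \<ge> 0" | "s2 > 0" "s1 < 0" | "s2 < 0" "s1 \<le> 0" | "s2 < 0" "s1 > 0" | "s2 = 0"
        using linorder_less_linear[of s2 0] linorder_le_less_linear[of s1 0] by fastforce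
      then show ?thesis
      proof cases
        case 1
        have "g i x > 0" if "x \<in> pts R2" "(i, j) \<in> E2" for i j x
        proof -
          have "Z i j x > 0" "Y i j x \<ge> 0" using 1 sgnY[OF that] sgnZ[OF that] by (auto simp: sgn_if split: if_splits)
          then show ?thesis using \<mu>(1)[OF that(2)] by (simp add: gi[of i x j] add_pos_nonneg)
        qed
        then have "\<forall>x\<in>pts R2. \<forall>(i, j)\<in>E2. sgn (g i x) = 1" by fastforce
        then show ?thesis by blast
      next
        case 2
        have "g j x > 0" if "x \<in> pts R2" "(i, j) \<in> E2" for i j x
        proof -
          have "Z i j x > 0" "Y i j x < 0" using 2 sgnY[OF that] sgnZ[OF that] by (auto simp: sgn_if split: if_splits)
          moreover have "(1 - \<mu> (i, j)) * Y i j x \<le> 0"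
            using \<mu>(2)[OF that(2)] calculation by (simp add: mult_nonneg_nonpos)
          ultimately show ?thesis unfolding gj[of j x i] by linarith
        qed
        then have "\<forall>x\<in>pts R2. \<forall>(i, j)\<in>E2. sgn (g j x) = 1" by fastforce
        then show ?thesis by blast
      next
        case 3
        have "g i x < 0" if "x \<in> pts R2" "(i, j) \<in> E2" for i j x
        proof -
          have "Z i j x < 0" "Y i j x \<le> 0" using 3 sgnY[OF that] sgnZ[OF that] by (auto simp: sgn_if split: if_splits)
          moreover have "\<mu> (i, j) * Y i j x \<le> 0"
            using \<mu>(1)[OF that(2)] calculation by (simp add: mult_nonneg_nonpos)
          ultimately show ?thesis unfolding gi[of i x j] by linarith
        qed
        then have "\<forall>x\<in>pts R2. \<forall>(i, j)\<in>E2. sgn (g i x) = - 1" by fastforce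
        then show ?thesis by blast
      next
        case 4
        have "g j x < 0" if "x \<in> pts R2" "(i, j) \<in> E2" for i j x
        proof -
          have "Z i j x < 0" "Y i j x > 0" using 4 sgnY[OF that] sgnZ[OF that] by (auto simp: sgn_if split: if_splits)
          moreover have "(1 - \<mu> (i, j)) * Y i j x \<ge> 0"
            using \<mu>(2)[OF that(2)] calculation by simp
          ultimately show ?thesis unfolding gj[of j x i] by linarith
        qed
        then have "\<forall>x\<in>pts R2. \<forall>(i, j)\<in>E2. sgn (g j x) = - 1" by fastforce
        then show ?thesis by blast
      next
        case 5
        have "sgn (g i x) = s1" if "x \<in> pts R2" "(i, j) \<in> E2" for i j x
        proof -
          have "Z i j x = 0" using 5 sgnZ[OF that] by (simp add: sgn_zero_iff)
          then show ?thesis using \<mu>(1)[OF that(2)] sgnY[OF that] by (simp add: gi[of i x j] sgn_mult)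
        qed
        then have "\<forall>x\<in>pts R2. \<forall>(i, j)\<in>E2. sgn (g i x) = s1" by fast
        then show ?thesis by blast
      qed
    qed
    then consider s where "\<forall>x\<in>pts R2. \<forall>(i, j)\<in>E2. sgn (g i x) = s"
      | s where "\<forall>x\<in>pts R2. \<forall>(i, j)\<in>E2. sgn (g j x) = s" by blast
    then show ?thesis
    proof cases
      case 1
      then have "constant_sign_on (\<lambda>(x, i). g i x) (pts R2 \<times> fst ` E2)"
        unfolding constant_sign_on_def by (intro exI[of _ s]) fastforce
      with ref sub(1) large(1) show ?thesis
        unfolding searchable_def g_def by blast
    next
      case 2
      then have "constant_sign_on (\<lambda>(x, i). g i x) (pts R2 \<times> snd ` E2)"
        unfolding constant_sign_on_def by (intro exI[of _ s]) fastforce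
      with ref sub(2) large(2) show ?thesis
        unfolding searchable_def g_def by blast
    qed
  qed
qed

text \<open>Passing from \<open>Suc n\<close> to \<open>t = Suc (Suc n)\<close> terms loses a factor
  3 for the sign of the last coefficient and \<open>4 * (N * N)\<close> for the normalised search,
  where \<open>N = 3 ^ (3 ^ Suc n)\<close>. Since \<open>12 \<le> N\<close>, the product is at most
  \<open>N ^ 3 = 3 ^ (3 ^ t)\<close>. Elimination involves two coefficients, so 0 and 1 terms are
  base cases.\<close>

lemma searchable_nat:
  fixes I :: "nat set"
  assumes "finite I" "\<forall>e<t. c e \<in> W"
  shows "searchable t c I a R (3 ^ t) (3 ^ (3 ^ t))"
  using assms
proof (induction t arbitrary: c I a R rule: less_induct)
  case (less t)
  consider "t = 0" | "t = 1" | n where "t = Suc (Suc n)"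
    by (metis One_nat_def not0_implies_Suc)
  then show ?case
  proof cases
    case 1
    have "refines 1 R R" using refines_mono[OF refines_refl] by simp
    with 1 show ?thesis
      unfolding searchable_def constant_sign_on_def by (intro exI[of _ R] exI[of _ I]) auto
  next
    case 2
    \<comment> \<open>The sign of a single term is a product: one refinement fixes the sign of
      \<open>c 0\<close>, and the pigeonhole principle that of \<open>a i 0\<close>.\<close>
    obtain R' s where R': "refines 1 R R'" and s: "\<forall>x\<in>pts R'. sgn (c 0 x) = s"
      using W_refines[of "c 0" R] less.prems 2 unfolding constant_sign_on_def by auto
    obtain s' where s': "card I \<le> 3 * card {i\<in>I. sgn (a i 0) = s'}"
      using large_sign_class[OF less.prems(1), of "\<lambda>i. a i 0"] by blast
    have "searchable t c I a R 1 3"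
      unfolding searchable_def constant_sign_on_def
      using R' s s' 2
      by (intro exI[of _ R'] exI[of _ "{i\<in>I. sgn (a i 0) = s'}"] conjI exI[of _ "s' * s"])
        (auto simp: sgn_mult)
    then show ?thesis using 2 by (elim searchable_mono) auto
  next
    case (3 n)
    define N :: nat where "N = 3 ^ (3 ^ Suc n)"
    have IH: "searchable (Suc n) c J a R (3 ^ Suc n) N"
      if "finite J" "\<forall>e<Suc n. c e \<in> W" for J :: "nat set" and c a R
      using less.IH[of "Suc n" J c a R] that 3 by (simp add: N_def)
    have "(3::nat) ^ 3 \<le> N"
      unfolding N_def by (rule power_increasing) auto
    then have N: "27 \<le> N" by simp
    have "3 ^ (3 ^ t) = N ^ 3"
      by (simp add: N_def 3 power_mult[symmetric] mult.commute)
    then have NN: "3 ^ (3 ^ t) = N * (N * N)"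
      by (simp add: power3_eq_cube)
    obtain s where s: "card I \<le> 3 * card {i\<in>I. sgn (a i (Suc n)) = s}"
      using large_sign_class[OF less.prems(1), of "\<lambda>i. a i (Suc n)"] by blast
    define I0 where "I0 = {i\<in>I. sgn (a i (Suc n)) = s}"
    have I0: "finite I0" "I0 \<subseteq> I" using less.prems by (auto simp: I0_def)
    have "searchable t c I0 a R (2 * 3 ^ Suc n) (4 * (N * N))"
    proof (cases "s = 0")
      case True
      \<comment> \<open>The last term vanishes for all forms in \<open>I0\<close>, so one term fewer
        remains.\<close>
      have "searchable (Suc n) c I0 a R (3 ^ Suc n) N"
        using IH I0 less.prems 3 by auto
      then have "searchable t c I0 a R (3 ^ Suc n) N"
        by (rule searchable_cong[where r = "\<lambda>_. 1" and s = 1])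
          (use True in \<open>auto simp: I0_def 3 sgn_zero_iff\<close>)
      then show ?thesis by (rule searchable_mono) (use N in auto)
    next
      case False
      have nz: "a i (Suc n) \<noteq> 0" if "i \<in> I0" for i
        using that False by (auto simp: I0_def)
      \<comment> \<open>Division makes the last coefficient 1; all divisors have the same sign
        \<open>s\<close>, so a constant sign of the quotients carries back.\<close>
      have "searchable t c I0 (\<lambda>i e. a i e / a i (Suc n)) R (2 * 3 ^ Suc n) (4 * (N * N))"
        unfolding 3
        by (rule searchable_normalised) (use IH N I0 less.prems 3 nz in auto)
      then show ?thesis
        by (rule searchable_cong[where r = "\<lambda>i. a i (Suc n)" and s = s])
          (use nz in \<open>auto simp: I0_def sum_distrib_left simp del: sum.lessThan_Suc\<close>)
    qed
    then have "searchable t c I a R (2 * 3 ^ Suc n) (3 * (4 * (N * N)))"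
      using I0(2) s unfolding I0_def by (rule searchable_subset)
    then show ?thesis
    proof (rule searchable_mono)
      show "3 * (4 * (N * N)) \<le> 3 ^ (3 ^ t)"
        unfolding NN using mult_le_mono1[of 12 N "N * N"] N by simp
    qed (simp add: 3)
  qed
qed

theorem multidimensional_search:
  fixes I :: "'i set"
  assumes "finite I" "\<forall>e<t. c e \<in> W"
  shows "searchable t c I a R (3 ^ t) (3 ^ (3 ^ t))"
  by (rule searchable_reindex) (use searchable_nat assms in auto)

end

section \<open>Separating one factor\<close>

lemma lookup_factor_part:
  "Poly_Mapping.lookup (factor_part i m) v = (if fst v = i then Poly_Mapping.lookup m v else 0)"
  by (simp add: factor_part.rep_eq)

lemma keys_factor_part: "Poly_Mapping.keys (factor_part i m) = {v \<in> Poly_Mapping.keys m. fst v = i}"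
  by (auto simp: in_keys_iff lookup_factor_part split: if_splits)

definition factor_rest :: "nat \<Rightarrow> monom \<Rightarrow> monom" where
  "factor_rest i m = m - factor_part i m"

lemma lookup_factor_rest:
  "Poly_Mapping.lookup (factor_rest i m) v = (if fst v = i then 0 else Poly_Mapping.lookup m v)"
  by (simp add: factor_rest_def lookup_minus lookup_factor_part)

lemma keys_factor_rest: "Poly_Mapping.keys (factor_rest i m) = {v \<in> Poly_Mapping.keys m. fst v \<noteq> i}"
  by (auto simp: in_keys_iff lookup_factor_rest split: if_splits)

text \<open>Stripping one factor leaves the term counts of the others unchanged, as the induction on
  factors requires.\<close>

lemma factor_part_factor_rest: "l \<noteq> i \<Longrightarrow> factor_part l (factor_rest i m) = factor_part l m"
  by (rule poly_mapping_eqI) (simp add: lookup_factor_part lookup_factor_rest)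

lemma eval_monom_cong:
  assumes "\<And>v. v \<in> Poly_Mapping.keys m \<Longrightarrow> p (fst v) = q (fst v)"
  shows "eval_monom m p = eval_monom m q"
  unfolding eval_monom_def using assms by (intro prod.cong) auto

lemma eval_monom_factor:
  "eval_monom m p = eval_monom (factor_part i m) p * eval_monom (factor_rest i m) p"
proof -
  let ?h = "\<lambda>v. (p (fst v) $ snd v) ^ Poly_Mapping.lookup m v"
  have "eval_monom (factor_part i m) p = prod ?h {v \<in> Poly_Mapping.keys m. fst v = i}"
    unfolding eval_monom_def keys_factor_part
    by (intro prod.cong) (auto simp: lookup_factor_part)
  moreover have "eval_monom (factor_rest i m) p = prod ?h {v \<in> Poly_Mapping.keys m. fst v \<noteq> i}"
    unfolding eval_monom_def keys_factor_rest
    by (intro prod.cong) (auto simp: lookup_factor_rest)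
  moreover have "eval_monom m p
    = prod ?h ({v \<in> Poly_Mapping.keys m. fst v = i} \<union> {v \<in> Poly_Mapping.keys m. fst v \<noteq> i})"
    unfolding eval_monom_def by (intro prod.cong) auto
  ultimately show ?thesis
    by (simp add: prod.union_disjoint disjoint_iff)
qed

section \<open>Refining multisets of points\<close>

text \<open>The support \<open>N\<close> is fixed while the coefficients are free and may vanish.
  All linear combinations met in the search thus share one bound, determined by
  \<open>N\<close>.\<close>

definition monom_sum :: "(monom \<Rightarrow> real) \<Rightarrow> monom set \<Rightarrow> (nat \<Rightarrow> real vec) \<Rightarrow> real" where
  "monom_sum b N p = (\<Sum>m\<in>N. b m * eval_monom m p)"

definition transversals :: "nat \<Rightarrow> (nat \<Rightarrow> 'a multiset) \<Rightarrow> (nat \<Rightarrow> 'a) set" where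
  "transversals k F = {p. \<forall>i\<in>{1..k}. p i \<in># F i}"

text \<open>\<open>B\<close> is the reciprocal of the retained proportion: it stays a natural number
  and multiplies under composition.\<close>

definition dense_subfamily :: "nat \<Rightarrow> nat \<Rightarrow> (nat \<Rightarrow> 'a multiset) \<Rightarrow> (nat \<Rightarrow> 'a multiset) \<Rightarrow> bool" where
  "dense_subfamily k B F F' \<longleftrightarrow> (\<forall>i\<in>{1..k}. F' i \<subseteq># F i \<and> size (F i) \<le> B * size (F' i))"

lemma dense_subfamily_refl: "dense_subfamily k 1 F F"
  by (simp add: dense_subfamily_def)

lemma dense_subfamily_trans:
  assumes "dense_subfamily k B F F'" "dense_subfamily k C F' F''"
  shows "dense_subfamily k (B * C) F F''"
  unfolding dense_subfamily_def
proof
  fix i assume i: "i \<in> {1..k}"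
  have F: "F' i \<subseteq># F i" "size (F i) \<le> B * size (F' i)"
    and F': "F'' i \<subseteq># F' i" "size (F' i) \<le> C * size (F'' i)"
    using assms i by (auto simp: dense_subfamily_def)
  have "size (F i) \<le> B * (C * size (F'' i))"
    using F(2) F'(2) by (meson mult_le_mono2 order_trans)
  then show "F'' i \<subseteq># F i \<and> size (F i) \<le> B * C * size (F'' i)"
    using F(1) F'(1) by (auto simp: mult.assoc intro: subset_mset.order_trans)
qed

lemma dense_subfamily_mono:
  assumes "dense_subfamily k B F F'" "B \<le> C"
  shows "dense_subfamily k C F F'"
  unfolding dense_subfamily_def
proof
  fix i assume "i \<in> {1..k}"
  then have "F' i \<subseteq># F i" "size (F i) \<le> B * size (F' i)"
    using assms(1) by (auto simp: dense_subfamily_def)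
  moreover have "B * size (F' i) \<le> C * size (F' i)"
    using assms(2) by (rule mult_le_mono1)
  ultimately show "F' i \<subseteq># F i \<and> size (F i) \<le> C * size (F' i)" by linarith
qed

lemma transversals_subset: "dense_subfamily k B F F' \<Longrightarrow> transversals k F' \<subseteq> transversals k F"
  unfolding dense_subfamily_def transversals_def by (auto dest: mset_subset_eqD)

section \<open>Adding one factor at a time\<close>

text \<open>Positions in a list stand for points with multiplicity, so a set of positions selects a
  submultiset.\<close>

lemma mset_nth_subset:
  assumes "I \<subseteq> {..<length ys}"
  shows "image_mset (nth ys) (mset_set I) \<subseteq># mset ys"
proof -
  have "image_mset (nth ys) (mset_set {..<length ys}) = mset (map (nth ys) [0..<length ys])"
    by (simp only: mset_map mset_upt atLeast0LessThan)
  then show ?thesis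
    using assms by (metis finite_lessThan image_mset_subseteq_mono map_nth subset_imp_msubset_mset_set)
qed

text \<open>With a single factor the points are simply sorted by sign. The loss 3 does not depend on
  the number of terms, which is why the first factor does not enter the exponent.\<close>

lemma same_sign_one_factor:
  fixes F :: "nat \<Rightarrow> real vec multiset"
  assumes vars: "\<And>m. m \<in> N \<Longrightarrow> fst ` Poly_Mapping.keys m \<subseteq> {1..1}"
  shows "\<exists>F'. dense_subfamily 1 3 F F' \<and> constant_sign_on (monom_sum b N) (transversals 1 F')"
proof -
  obtain ys where ys: "mset ys = F 1" using ex_mset by blast
  obtain s where s: "card {..<length ys}
    \<le> 3 * card {i\<in>{..<length ys}. sgn (monom_sum b N (\<lambda>_. ys ! i)) = s}"
    using large_sign_class[of "{..<length ys}" "\<lambda>i. monom_sum b N (\<lambda>_. ys ! i)"] by auto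
  define I where "I = {i\<in>{..<length ys}. sgn (monom_sum b N (\<lambda>_. ys ! i)) = s}"
  define F' where "F' = F(1 := image_mset (nth ys) (mset_set I))"
  have "F' 1 \<subseteq># F 1"
    using mset_nth_subset[of I ys] by (auto simp: F'_def I_def ys)
  moreover have "size (F 1) = length ys" using ys by (metis size_mset)
  then have "size (F 1) \<le> 3 * size (F' 1)"
    using s by (simp add: F'_def I_def)
  ultimately have "dense_subfamily 1 3 F F'"
    by (simp add: dense_subfamily_def)
  moreover have "sgn (monom_sum b N p) = s" if "p \<in> transversals 1 F'" for p
  proof -
    have "finite I" by (simp add: I_def)
    moreover have "p 1 \<in># F' 1" using that by (simp add: transversals_def)
    ultimately obtain i where i: "i \<in> I" "p 1 = ys ! i"
      by (auto simp: F'_def)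
    have "monom_sum b N p = monom_sum b N (\<lambda>_. ys ! i)"
      unfolding monom_sum_def
    proof (rule sum.cong[OF refl])
      fix m assume "m \<in> N"
      then have "eval_monom m p = eval_monom m (\<lambda>_. ys ! i)"
        using vars i(2) by (intro eval_monom_cong) fastforce
      then show "b m * eval_monom m p = b m * eval_monom m (\<lambda>_. ys ! i)" by simp
    qed
    then show ?thesis using i(1) by (simp add: I_def)
  qed
  ultimately show ?thesis unfolding constant_sign_on_def by blast
qed

text \<open>The abstract search is applied with families on the first \<open>k\<close> factors as
  refinable objects and the points of the new factor as forms. The hypothesis \<open>IH\<close> for
  arbitrary coefficients supplies the refinement for a single function. As \<open>B \<ge> 3\<close>,
  the loss \<open>3 ^ (3 ^ t)\<close> among the points is covered by \<open>B ^ (3 ^ t)\<close>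
  too.\<close>

lemma same_sign_add_factor:
  fixes F :: "nat \<Rightarrow> real vec multiset" and B :: nat
  assumes "finite N"
    and IH: "\<And>b F. \<exists>F'. dense_subfamily k B F F' \<and>
      constant_sign_on (monom_sum b (factor_rest (Suc k) ` N)) (transversals k F')"
    and "B \<ge> 3"
  defines "t \<equiv> card (factor_part (Suc k) ` N)"
  shows "\<exists>F'. dense_subfamily (Suc k) (B ^ (3 ^ t)) F F' \<and>
    constant_sign_on (monom_sum b N) (transversals (Suc k) F')"
proof -
  define E where "E = factor_part (Suc k) ` N"
  define rsum where "rsum = (\<lambda>b p. \<Sum>m\<in>N. b m * eval_monom (factor_rest (Suc k) m) p)"
  have finE: "finite E" using assms(1) by (simp add: E_def)
  obtain en where en: "bij_betw en {..<t} E"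
    using ex_bij_betw_nat_finite[OF finE] by (auto simp: t_def E_def atLeast0LessThan)
  obtain ys where ys: "mset ys = F (Suc k)" using ex_mset by blast
  \<comment> \<open>Different monomials of \<open>N\<close> may have the same rest, so their
    coefficients are added to obtain a sum over the image of \<open>N\<close>.\<close>
  have rsum_eq: "rsum b = monom_sum (\<lambda>n. \<Sum>m\<in>{m\<in>N. factor_rest (Suc k) m = n}. b m) (factor_rest (Suc k) ` N)" for b
  proof
    fix p
    show "rsum b p = monom_sum (\<lambda>n. \<Sum>m\<in>{m\<in>N. factor_rest (Suc k) m = n}. b m) (factor_rest (Suc k) ` N) p"
      unfolding rsum_def monom_sum_def
      by (subst sum.image_gen[OF assms(1), where g = "factor_rest (Suc k)"])
        (auto simp: sum_distrib_right intro!: sum.cong)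
  qed
  interpret sign_refinement "transversals k" "\<lambda>m. dense_subfamily k (B ^ m)" "range rsum"
  proof
    show "dense_subfamily k (B ^ 0) R R" for R :: "nat \<Rightarrow> real vec multiset"
      using dense_subfamily_refl by simp
    show "dense_subfamily k (B ^ (m + n)) R R''"
      if "dense_subfamily k (B ^ m) R R'" "dense_subfamily k (B ^ n) R' R''" for m n and R R' R'' :: "nat \<Rightarrow> real vec multiset"
      using dense_subfamily_trans[OF that] by (simp add: power_add)
    show "dense_subfamily k (B ^ n) R R'"
      if "dense_subfamily k (B ^ m) R R'" "m \<le> n" for m n and R R' :: "nat \<Rightarrow> real vec multiset"
      using that(1) by (rule dense_subfamily_mono) (use that \<open>B \<ge> 3\<close> in \<open>auto intro: power_increasing\<close>)
    show "transversals k R' \<subseteq> transversals k R"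
      if "dense_subfamily k (B ^ m) R R'" for m and R R' :: "nat \<Rightarrow> real vec multiset"
      using that by (rule transversals_subset)
    show "(\<lambda>x. r * g x + h x) \<in> range rsum" if gh: "g \<in> range rsum" "h \<in> range rsum" for r g h
    proof -
      obtain b b' where "g = rsum b" "h = rsum b'" using gh by blast
      then have "(\<lambda>x. r * g x + h x) = rsum (\<lambda>m. r * b m + b' m)"
        by (simp add: rsum_def fun_eq_iff sum_distrib_left sum.distrib algebra_simps)
      then show ?thesis by blast
    qed
    show "\<exists>R'. dense_subfamily k (B ^ 1) R R' \<and> constant_sign_on h (transversals k R')"
      if "h \<in> range rsum" for h R
      using that IH rsum_eq by auto
  qed
  \<comment> \<open>\<open>c e\<close> collects the terms of the polynomial whose part in the last
    factor is \<open>en e\<close>; \<open>a i e\<close> is the value of that part at the point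
    \<open>ys ! i\<close>.\<close>
  define c where "c = (\<lambda>e. rsum (\<lambda>m. if factor_part (Suc k) m = en e then b m else 0))"
  define a where "a = (\<lambda>i e. eval_monom (en e) (\<lambda>_. ys ! i))"
  have expand: "monom_sum b N p = (\<Sum>e<t. a i e * c e p)" if p: "p (Suc k) = ys ! i" for p i
  proof -
    have "(\<Sum>e<t. a i e * c e p)
      = (\<Sum>e\<in>E. eval_monom e (\<lambda>_. ys ! i) * rsum (\<lambda>m. if factor_part (Suc k) m = e then b m else 0) p)"
      unfolding a_def c_def by (rule sum.reindex_bij_betw[OF en])
    also have "\<dots> = (\<Sum>e\<in>E. \<Sum>m\<in>N. if factor_part (Suc k) m = e
        then eval_monom e (\<lambda>_. ys ! i) * (b m * eval_monom (factor_rest (Suc k) m) p) else 0)"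
      unfolding rsum_def sum_distrib_left by (intro sum.cong) auto
    also have "\<dots> = (\<Sum>m\<in>N. \<Sum>e\<in>E. if factor_part (Suc k) m = e
        then eval_monom e (\<lambda>_. ys ! i) * (b m * eval_monom (factor_rest (Suc k) m) p) else 0)"
      by (rule sum.swap)
    also have "\<dots> = (\<Sum>m\<in>N. eval_monom (factor_part (Suc k) m) (\<lambda>_. ys ! i) *
        (b m * eval_monom (factor_rest (Suc k) m) p))"
      using finE by (intro sum.cong) (auto simp: E_def)
    also have "\<dots> = monom_sum b N p"
      unfolding monom_sum_def
    proof (rule sum.cong[OF refl])
      fix m
      have "eval_monom (factor_part (Suc k) m) (\<lambda>_. ys ! i) = eval_monom (factor_part (Suc k) m) p"
        by (rule eval_monom_cong) (auto simp: keys_factor_part p)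
      then show "eval_monom (factor_part (Suc k) m) (\<lambda>_. ys ! i) *
          (b m * eval_monom (factor_rest (Suc k) m) p) = b m * eval_monom m p"
        by (simp add: eval_monom_factor[of m p "Suc k"])
    qed
    finally show ?thesis by simp
  qed
  have "searchable t c {..<length ys} a F (3 ^ t) (3 ^ (3 ^ t))"
    by (rule multidimensional_search) (auto simp: c_def)
  then obtain R I s where R: "dense_subfamily k (B ^ (3 ^ t)) F R"
    and I: "I \<subseteq> {..<length ys}" "card {..<length ys} \<le> 3 ^ (3 ^ t) * card I"
    and s: "\<And>p i. p \<in> transversals k R \<Longrightarrow> i \<in> I \<Longrightarrow> sgn (\<Sum>e<t. a i e * c e p) = s"
    using searchableE by blast
  \<comment> \<open>\<open>R\<close> is controlled only on the factors up to \<open>k\<close>; its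
    entry at \<open>Suc k\<close> is replaced by the points that the search selected.\<close>
  define F' where "F' = R(Suc k := image_mset (nth ys) (mset_set I))"
  have "finite I" using I(1) finite_subset by blast
  have "size (F (Suc k)) \<le> B ^ (3 ^ t) * size (F' (Suc k))"
  proof -
    have "size (F (Suc k)) \<le> 3 ^ (3 ^ t) * card I"
      using I(2) by (simp flip: ys)
    also have "\<dots> \<le> B ^ (3 ^ t) * card I"
      using \<open>B \<ge> 3\<close> by (intro mult_le_mono1 power_mono) auto
    finally show ?thesis by (simp add: F'_def)
  qed
  moreover have "F' (Suc k) \<subseteq># F (Suc k)"
    using mset_nth_subset[OF I(1)] by (simp add: F'_def ys)
  ultimately have "dense_subfamily (Suc k) (B ^ (3 ^ t)) F F'"
    using R unfolding dense_subfamily_def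
    by (auto simp: F'_def le_Suc_eq)
  moreover have "sgn (monom_sum b N p) = s" if p: "p \<in> transversals (Suc k) F'" for p
  proof -
    have "p \<in> transversals k R"
      unfolding transversals_def
    proof (intro CollectI ballI)
      fix i assume "i \<in> {1..k}"
      moreover from this have "p i \<in># F' i" using p by (simp add: transversals_def)
      ultimately show "p i \<in># R i" by (simp add: F'_def)
    qed
    moreover have "p (Suc k) \<in># F' (Suc k)" using p by (simp add: transversals_def)
    then obtain i where "i \<in> I" "p (Suc k) = ys ! i"
      using \<open>finite I\<close> by (auto simp: F'_def)
    ultimately show ?thesis using s expand by simp
  qed
  ultimately show ?thesis unfolding constant_sign_on_def by blast
qed

text \<open>Raising \<open>3 ^ (3 ^ T)\<close> to the power \<open>3 ^ t\<close> gives
  \<open>3 ^ (3 ^ (T + t))\<close>, so term counts add up in the exponent. For \<open>k = 1\<close>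
  the sum is empty and the bound is \<open>3 ^ (3 ^ 0) = 3\<close>, as for one factor.\<close>

lemma same_sign_monom_sum:
  fixes F :: "nat \<Rightarrow> real vec multiset"
  assumes "finite N" "\<And>m. m \<in> N \<Longrightarrow> fst ` Poly_Mapping.keys m \<subseteq> {1..k}"
  shows "\<exists>F'. dense_subfamily k (3 ^ (3 ^ (\<Sum>l=2..k. card (factor_part l ` N)))) F F' \<and>
    constant_sign_on (monom_sum b N) (transversals k F')"
  using assms
proof (induction k arbitrary: N b F)
  case 0
  \<comment> \<open>Without factors only the empty monomial can occur, so the sum is
    constant.\<close>
  have "eval_monom m p = 1" if "m \<in> N" for m p
    using 0(2)[OF that] by (simp add: eval_monom_def)
  then have "constant_sign_on (monom_sum b N) (transversals 0 F)"
    by (auto simp: constant_sign_on_def monom_sum_def)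
  then show ?case by (auto simp: dense_subfamily_def)
next
  case (Suc k)
  show ?case
  proof (cases "k = 0")
    case True
    then show ?thesis using same_sign_one_factor[of N F b] Suc.prems(2) by auto
  next
    case False
    define T where "T = (\<Sum>l=2..k. card (factor_part l ` N))"
    have "factor_part l ` factor_rest (Suc k) ` N = factor_part l ` N" if "l \<in> {2..k}" for l
      using that by (simp add: image_image factor_part_factor_rest)
    then have T: "(\<Sum>l=2..k. card (factor_part l ` factor_rest (Suc k) ` N)) = T"
      by (simp add: T_def)
    have vars: "fst ` Poly_Mapping.keys m \<subseteq> {1..k}" if "m \<in> factor_rest (Suc k) ` N" for m
    proof -
      obtain n where n: "n \<in> N" "m = factor_rest (Suc k) n" using \<open>m \<in> _\<close> by blast
      show ?thesis
      proof
        fix i assume "i \<in> fst ` Poly_Mapping.keys m"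
        then have "i \<in> fst ` Poly_Mapping.keys n" "i \<noteq> Suc k"
          by (auto simp: n(2) keys_factor_rest)
        then show "i \<in> {1..k}" using Suc.prems(2)[OF n(1)] by fastforce
      qed
    qed
    have "\<exists>F'. dense_subfamily (Suc k) ((3 ^ (3 ^ T)) ^ (3 ^ card (factor_part (Suc k) ` N))) F F' \<and>
      constant_sign_on (monom_sum b N) (transversals (Suc k) F')"
    proof (rule same_sign_add_factor[OF Suc.prems(1)])
      show "\<exists>F'. dense_subfamily k (3 ^ (3 ^ T)) F F' \<and>
        constant_sign_on (monom_sum b (factor_rest (Suc k) ` N)) (transversals k F')"
        for b and F :: "nat \<Rightarrow> real vec multiset"
        using Suc.IH[of "factor_rest (Suc k) ` N" F b] vars Suc.prems(1) T by auto
      show "(3::nat) \<le> 3 ^ (3 ^ T)"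
        using power_increasing[of 1 "3 ^ T" "3::nat"] by simp
    qed
    moreover have "((3::nat) ^ (3 ^ T)) ^ (3 ^ card (factor_part (Suc k) ` N))
      = 3 ^ (3 ^ (\<Sum>l=2..Suc k. card (factor_part l ` N)))"
      using False by (simp add: T_def power_add flip: power_mult)
    ultimately show ?thesis by simp
  qed
qed

section \<open>Several polynomials, and the proportion as a real number\<close>

text \<open>The polynomials are treated one after another. Signs already fixed survive further
  refinement because the transversals only shrink, and the losses multiply.\<close>

lemma same_signs:
  fixes f :: "nat \<Rightarrow> rpoly" and F :: "nat \<Rightarrow> real vec multiset"
  assumes "\<forall>j\<in>{1..J}. f j \<in> polys_on k d"
  shows "\<exists>F'. dense_subfamily k (\<Prod>j=1..J. 3 ^ (3 ^ (\<Sum>l=2..k. num_terms l (f j)))) F F' \<and>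
    (\<forall>j\<in>{1..J}. constant_sign_on (eval_rpoly (f j)) (transversals k F'))"
  using assms
proof (induction J)
  case 0
  then show ?case using dense_subfamily_refl by auto
next
  case (Suc J)
  then obtain G where G: "dense_subfamily k (\<Prod>j=1..J. 3 ^ (3 ^ (\<Sum>l=2..k. num_terms l (f j)))) F G"
    and signG: "\<forall>j\<in>{1..J}. constant_sign_on (eval_rpoly (f j)) (transversals k G)"
    by auto
  have "fst ` Poly_Mapping.keys m \<subseteq> {1..k}" if "m \<in> Poly_Mapping.keys (f (Suc J))" for m
    using Suc.prems that by (fastforce simp: polys_on_def)
  then obtain F' where F': "dense_subfamily k (3 ^ (3 ^ (\<Sum>l=2..k. num_terms l (f (Suc J))))) G F'"
    and sign: "constant_sign_on (monom_sum (Poly_Mapping.lookup (f (Suc J))) (Poly_Mapping.keys (f (Suc J))))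
      (transversals k F')"
    using same_sign_monom_sum[of "Poly_Mapping.keys (f (Suc J))" k G "Poly_Mapping.lookup (f (Suc J))"]
    unfolding num_terms_eq by auto
  have "constant_sign_on (eval_rpoly (f j)) (transversals k F')" if "j \<in> {1..Suc J}" for j
  proof (cases "j = Suc J")
    case True
    then show ?thesis using sign by (simp add: constant_sign_on_def monom_sum_def eval_rpoly_def)
  next
    case False
    then have "constant_sign_on (eval_rpoly (f j)) (transversals k G)" using signG that by simp
    then show ?thesis using transversals_subset[OF F'] unfolding constant_sign_on_def by blast
  qed
  then show ?case using dense_subfamily_trans[OF G F'] by auto
qed

theorem theorem4:
  fixes k J :: nat
    and d :: "nat \<Rightarrow> nat"
    and f :: "nat \<Rightarrow> rpoly"
    and F :: "nat \<Rightarrow> real vec multiset"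
  assumes "\<forall>i\<in>{1..k}. d i > 0"
    and "\<forall>j\<in>{1..J}. f j \<in> polys_on k d"
    and "\<forall>i\<in>{1..k}. set_mset (F i) \<subseteq> carrier_vec (d i)"
  shows "\<exists>F' :: nat \<Rightarrow> real vec multiset.
    (\<forall>i\<in>{1..k}. F' i \<subseteq># F i) \<and>
    (\<forall>i\<in>{1..k}. real (size (F' i)) \<ge>
       (\<Prod>j=1..J. 1 / 3 ^ (3 ^ (\<Sum>l=2..k. num_terms l (f j)))) * real (size (F i))) \<and>
    (\<forall>j\<in>{1..J}. \<forall>p q.
       (\<forall>i\<in>{1..k}. p i \<in># F' i) \<longrightarrow> (\<forall>i\<in>{1..k}. q i \<in># F' i) \<longrightarrow>
       sgn (eval_rpoly (f j) p) = sgn (eval_rpoly (f j) q))"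
proof -
  define B :: nat where "B = (\<Prod>j=1..J. 3 ^ (3 ^ (\<Sum>l=2..k. num_terms l (f j))))"
  obtain F' where F': "dense_subfamily k B F F'"
    and sign: "\<forall>j\<in>{1..J}. constant_sign_on (eval_rpoly (f j)) (transversals k F')"
    using same_signs[OF assms(2), of F] unfolding B_def by blast
  have "B > 0" unfolding B_def by (intro prod_pos) auto
  \<comment> \<open>The proportion in the statement is the reciprocal of the natural number
    \<open>B\<close>, so the size bound follows on dividing by \<open>B\<close>.\<close>
  have eps: "(\<Prod>j=1..J. 1 / 3 ^ (3 ^ (\<Sum>l=2..k. num_terms l (f j)))) = 1 / real B"
    by (simp add: B_def prod_dividef)
  show ?thesis
    unfolding eps
  proof (intro exI[of _ F'] conjI ballI allI impI)
    fix i assume "i \<in> {1..k}"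
    then have *: "F' i \<subseteq># F i" "size (F i) \<le> B * size (F' i)"
      using F' by (auto simp: dense_subfamily_def)
    show "F' i \<subseteq># F i" by (fact *)
    have "real (size (F i)) \<le> real B * real (size (F' i))"
      using *(2) by (metis of_nat_le_iff of_nat_mult)
    then show "1 / real B * real (size (F i)) \<le> real (size (F' i))"
      using \<open>B > 0\<close> by (simp add: divide_simps mult.commute)
  next
    fix j p q
    assume "j \<in> {1..J}" "\<forall>i\<in>{1..k}. p i \<in># F' i" "\<forall>i\<in>{1..k}. q i \<in># F' i"
    then have "p \<in> transversals k F'" "q \<in> transversals k F'"
      by (auto simp: transversals_def)
    then show "sgn (eval_rpoly (f j) p) = sgn (eval_rpoly (f j) q)"
      using sign \<open>j \<in> {1..J}\<close> by (metis constant_sign_on_def)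
  qed
qed

end
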